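(* The triples formulation is a valid model of the BPMP. That is, for every BPMP instance, the optimal objective value of the triples formulation equals the maximum profit of the BPMP instance, and for every optimal solution $(x,y,\theta,u,s)$ of the triples formulation, the route formed by the arcs $(i,j)\in\mathcal{A}$ with $x_{ij}=1$, together with the set of accepted requests $\{(k,l)\in\mathcal{R}: y_{kl}=1\}$, is an optimal solution of the BPMP instance.
   Context: BPMP instance: an integer $n$; node set $\mathcal{N}=\{1,\dots,n\}$; arc set $\mathcal{A}=\{(i,j): i,j\in\mathcal{N},\ i<n,\ j>1,\ i\neq j\}$; nonnegative distances $d_{ij}$ for $(i,j)\in\mathcal{A}$ satisfying the triangle inequality; delivery requests $\mathcal{R}\subseteq\mathcal{A}$ with weights $w_{ij}>0$ for $(i,j)\in\mathcal{R}$ and the convention $w_{ij}=0$ for $(i,j)\in\mathcal{A}\setminus\mathcal{R}$; nonnegative parameters $p$ (price), $c$ (travel cost), $v$ (vehicle weight), $Q$ (capacity), $D$ (distance limit). BPMP: a feasible solution consists of a route $P$ and a set $S\subseteq\mathcal{R}$ of accepted requests such that: (1) $P$ is a simple directed path from node $1$ to node $n$ with arcs in $\mathcal{A}$ and $\sum_{(i,j)\in P}d_{ij}\le D$; (2) for each $(k,l)\in S$ the route $P$ visits node $k$ and later visits node $l$; (3) for each arc $(i,j)$ of $P$, the load $\theta^{P,S}_{ij}$, defined as the sum of $w_{kl}$ over all $(k,l)\in S$ such that $(i,j)$ lies on the part of $P$ from $k$ to $l$, satisfies $\theta^{P,S}_{ij}\le Q$. Its profit is $p\sum_{(k,l)\in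 S}d_{kl}w_{kl}-c\sum_{(i,j)\in P}d_{ij}\theta^{P,S}_{ij}-cv\sum_{(i,j)\in P}d_{ij}$, and the BPMP is to maximize profit over feasible solutions. Triples: $\mathcal{T}=\{(i,j,k): i\in\mathcal{N}\setminus\{n\},\ j\in\mathcal{N}\setminus\{1,i\},\ k\in\mathcal{N}\setminus\{1,n,i,j\}\}$. The triples formulation has variables $x_{ij}$, $\theta_{ij}$ for $(i,j)\in\mathcal{A}$; $y_{ij}$ for $(i,j)\in\mathcal{R}$ (a product $w_{ij}y_{ij}$ with $(i,j)\notin\mathcal{R}$ is read as $0$); $u_{ij}^k$ for $(i,j,k)\in\mathcal{T}$; and $s_i$ for $i\in\mathcal{N}$. It maximizes $$p\sum_{(k,l)\in\mathcal{R}}d_{kl}w_{kl}y_{kl}-c\sum_{(i,j)\in\mathcal{A}}d_{ij}\theta_{ij}-cv\sum_{(i,j)\in\mathcal{A}}d_{ij}x_{ij}$$ subject to: - $\sum_{j=2}^n x_{1j}=1$ and $\sum_{i=1}^{n-1}x_{in}=1$; - $\sum_{i\in\mathcal{N}\setminus\{k,n\}}x_{ik}=\sum_{j\in\mathcal{N}\setminus\{1,k\}}x_{kj}$ for all $k\in\mathcal{N}\setminus\{1,n\}$; - $\sum_{(i,j)\in\mathcal{A}}d_{ij}x_{ij}\le D$; - $s_i-s_j+(n+1)x_{ij}\le n$ for all $(i,j)\in\mathcal{A}$, and $s_i\ge 0$ for all $i\in\mathcal{N}$; - $\theta_{ij}\le Qx_{ij}$ for all $(i,j)\in\mathcal{A}$;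 - $\theta_{ij}=w_{ij}y_{ij}+\sum_{k:(i,k,j)\in\mathcal{T}}u_{ik}^j+\sum_{k:(k,j,i)\in\mathcal{T}}u_{kj}^i-\sum_{k:(i,j,k)\in\mathcal{T}}u_{ij}^k$ for all $(i,j)\in\mathcal{A}$; - $\theta_{ij}\ge 0$ for all $(i,j)\in\mathcal{A}$; - $u_{ij}^k\le Qx_{ik}$ and $u_{ij}^k\ge 0$ for all $(i,j,k)\in\mathcal{T}$; - $x_{ij}\in\{0,1\}$ for $(i,j)\in\mathcal{A}$ and $y_{ij}\in\{0,1\}$ for $(i,j)\in\mathcal{R}$. If no feasible solution exists, the maximum value of either problem is regarded as $-\infty$. *)

theory Defs
  imports
    "HOL-Library.Extended_Real"
    "HOL-Library.Sublist"
    "Graph_Theory.Arc_Walk"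
begin

record bpmp =
  num_nodes :: nat
  distance :: "nat \<Rightarrow> nat \<Rightarrow> real"
  requests :: "(nat \<times> nat) set"
  weight :: "nat \<Rightarrow> nat \<Rightarrow> real"
  price :: real
  travel_cost :: real
  vehicle_weight :: real
  capacity :: real
  distance_limit :: real

definition nodes :: "bpmp \<Rightarrow> nat set" where
  "nodes I = {1..num_nodes I}"

definition arc_set :: "bpmp \<Rightarrow> (nat \<times> nat) set" where
  "arc_set I = {(i, j). i \<in> nodes I \<and> j \<in> nodes I \<and> i < num_nodes I \<and> j > 1 \<and> i \<noteq> j}"

text \<open>
  The origin 1 and the destination \<open>num_nodes I\<close> are distinct nodes, whence the bound 2.
  For a single node the statement would fail: the empty path is then a route, but the
  formulation requires an empty sum to be 1.
\<close>

definition bpmp_instance :: "bpmp \<Rightarrow> bool" where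
  "bpmp_instance I \<longleftrightarrow>
     num_nodes I \<ge> 2 \<and>
     (\<forall>(i, j) \<in> arc_set I. distance I i j \<ge> 0) \<and>
     (\<forall>i j k. (i, j) \<in> arc_set I \<and> (j, k) \<in> arc_set I \<and> (i, k) \<in> arc_set I \<longrightarrow>
        distance I i k \<le> distance I i j + distance I j k) \<and>
     requests I \<subseteq> arc_set I \<and>
     (\<forall>(i, j) \<in> requests I. weight I i j > 0) \<and>
     (\<forall>(i, j) \<in> arc_set I - requests I. weight I i j = 0) \<and>
     price I \<ge> 0 \<and> travel_cost I \<ge> 0 \<and> vehicle_weight I \<ge> 0 \<and>
     capacity I \<ge> 0 \<and> distance_limit I \<ge> 0"


section \<open>Routes and accepted requests\<close>

text \<open>
  A candidate solution is a pair \<open>(P, S)\<close>: the list of arcs of the route, in the order of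
  travel, and the set of accepted requests.
\<close>

type_synonym bpmp_sol = "(nat \<times> nat) list \<times> (nat \<times> nat) set"

definition bpmp_graph :: "bpmp \<Rightarrow> (nat, nat \<times> nat) pre_digraph" where
  "bpmp_graph I = \<lparr>verts = nodes I, arcs = arc_set I, tail = fst, head = snd\<rparr>"

text \<open>
  \<open>q\<close> is the part of the route \<open>P\<close> from node \<open>k\<close> to a later node \<open>l\<close>. For a simple path it is
  unique if it exists, and it exists iff \<open>P\<close> visits \<open>k\<close> and later visits \<open>l\<close>.
\<close>

definition route_part ::
    "bpmp \<Rightarrow> (nat \<times> nat) list \<Rightarrow> nat \<Rightarrow> nat \<Rightarrow> (nat \<times> nat) list \<Rightarrow> bool" where
  "route_part I P k l q \<longleftrightarrow>
     sublist q P \<and> q \<noteq> [] \<and> pre_digraph.awalk (bpmp_graph I) k q l"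

definition load :: "bpmp \<Rightarrow> (nat \<times> nat) list \<Rightarrow> (nat \<times> nat) set \<Rightarrow> nat \<Rightarrow> nat \<Rightarrow> real" where
  "load I P S i j =
     (\<Sum>(k, l) \<in> {(k, l) \<in> S. \<exists>q. route_part I P k l q \<and> (i, j) \<in> set q}. weight I k l)"

fun bpmp_feasible :: "bpmp \<Rightarrow> bpmp_sol \<Rightarrow> bool" where
  "bpmp_feasible I (P, S) \<longleftrightarrow>
     pre_digraph.apath (bpmp_graph I) 1 P (num_nodes I) \<and>
     (\<Sum>(i, j) \<in> set P. distance I i j) \<le> distance_limit I \<and>
     S \<subseteq> requests I \<and>
     (\<forall>(k, l) \<in> S. \<exists>q. route_part I P k l q) \<and>
     (\<forall>(i, j) \<in> set P. load I P S i j \<le> capacity I)"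

fun bpmp_profit :: "bpmp \<Rightarrow> bpmp_sol \<Rightarrow> real" where
  "bpmp_profit I (P, S) =
     price I * (\<Sum>(k, l) \<in> S. distance I k l * weight I k l)
     - travel_cost I * (\<Sum>(i, j) \<in> set P. distance I i j * load I P S i j)
     - travel_cost I * vehicle_weight I * (\<Sum>(i, j) \<in> set P. distance I i j)"


section \<open>The triples formulation\<close>

definition triples :: "bpmp \<Rightarrow> (nat \<times> nat \<times> nat) set" where
  "triples I = {(i, j, k). i \<in> nodes I - {num_nodes I} \<and> j \<in> nodes I - {1, i} \<and>
                            k \<in> nodes I - {1, num_nodes I, i, j}}"

text \<open>
  The variables are \<open>(x, y, \<theta>, u, s)\<close>, with \<open>u i j k\<close> for the variable with lower indices
  \<open>i\<close>, \<open>j\<close> and upper index \<open>k\<close>. They are total functions; neither the constraints nor the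
  objective refer to values outside the index sets.
\<close>

type_synonym triples_sol =
  "(nat \<Rightarrow> nat \<Rightarrow> real) \<times> (nat \<Rightarrow> nat \<Rightarrow> real) \<times> (nat \<Rightarrow> nat \<Rightarrow> real) \<times>
   (nat \<Rightarrow> nat \<Rightarrow> nat \<Rightarrow> real) \<times> (nat \<Rightarrow> real)"

definition triples_feasible :: "bpmp \<Rightarrow> triples_sol \<Rightarrow> bool" where
  "triples_feasible I = (\<lambda>(x, y, \<theta>, u, s).
      let n = num_nodes I; N = nodes I; A = arc_set I; R = requests I; T = triples I;
          Q = capacity I
      in
        (\<Sum>j = 2..n. x 1 j) = 1 \<and>
        (\<Sum>i = 1..n - 1. x i n) = 1 \<and>
        (\<forall>k \<in> N - {1, n}. (\<Sum>i \<in> N - {k, n}. x i k) = (\<Sum>j \<in> N - {1, k}. x k j)) \<and>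
        (\<Sum>(i, j) \<in> A. distance I i j * x i j) \<le> distance_limit I \<and>
        (\<forall>(i, j) \<in> A. s i - s j + (real n + 1) * x i j \<le> real n) \<and>
        (\<forall>i \<in> N. s i \<ge> 0) \<and>
        (\<forall>(i, j) \<in> A. \<theta> i j \<le> Q * x i j) \<and>
        (\<forall>(i, j) \<in> A. \<theta> i j =
             (if (i, j) \<in> R then weight I i j * y i j else 0)
             + (\<Sum>k \<in> {k. (i, k, j) \<in> T}. u i k j)
             + (\<Sum>k \<in> {k. (k, j, i) \<in> T}. u k j i)
             - (\<Sum>k \<in> {k. (i, j, k) \<in> T}. u i j k)) \<and>
        (\<forall>(i, j) \<in> A. \<theta> i j \<ge> 0) \<and>
        (\<forall>(i, j, k) \<in> T. u i j k \<le> Q * x i k \<and> u i j k \<ge> 0) \<and>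
        (\<forall>(i, j) \<in> A. x i j \<in> {0, 1}) \<and>
        (\<forall>(i, j) \<in> R. y i j \<in> {0, 1}))"

fun triples_objective :: "bpmp \<Rightarrow> triples_sol \<Rightarrow> real" where
  "triples_objective I (x, y, \<theta>, u, s) =
     price I * (\<Sum>(k, l) \<in> requests I. distance I k l * weight I k l * y k l)
     - travel_cost I * (\<Sum>(i, j) \<in> arc_set I. distance I i j * \<theta> i j)
     - travel_cost I * vehicle_weight I * (\<Sum>(i, j) \<in> arc_set I. distance I i j * x i j)"


section \<open>Optimal values\<close>

text \<open>
  A relation rather than a supremum, so that the maximum of a problem with feasible solutions
  has to be attained.
\<close>

definition has_max_value :: "('a \<Rightarrow> real) \<Rightarrow> ('a \<Rightarrow> bool) \<Rightarrow> ereal \<Rightarrow> bool" where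
  "has_max_value f feasible v \<longleftrightarrow>
     (if \<exists>z. feasible z then \<exists>z. is_arg_max f feasible z \<and> v = ereal (f z) else v = -\<infinity>)"

lemma has_max_value_unique:
  assumes "has_max_value f feasible v" and "has_max_value f feasible v'"
  shows "v = v'"
proof (cases "\<exists>z. feasible z")
  case True
  then obtain z z' where "is_arg_max f feasible z" "v = ereal (f z)"
    and "is_arg_max f feasible z'" "v' = ereal (f z')"
    using assms unfolding has_max_value_def by auto
  then show ?thesis
    by (auto simp: is_arg_max_def not_less intro: antisym)
next
  case False
  then show ?thesis
    using assms by (simp add: has_max_value_def)
qed

end

theory Submission
  imports Defs
begin

text \<open>
  The triples formulation and the BPMP are related by two maps between their feasible solutions,
  neither of which loses value.

  A route with accepted requests is turned into a solution of the formulation with the same value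
  (\<open>triples_solution_of_route\<close>). The balance constraints start from the fiction that every accepted
  request \<open>(i, j)\<close> travels on the direct arc \<open>(i, j)\<close>; the variable \<open>u i j k\<close> moves goods from this arc to
  the two arcs \<open>(i, k)\<close> and \<open>(k, j)\<close>. On a given route, all goods that are at a node and go beyond the
  next node are diverted through that next node. Repeating this along the route leaves on each arc
  of the route precisely its load, and nothing on the other arcs.

  Conversely, the arcs selected by a feasible solution of the formulation form a simple path
  (\<open>selected_arcs_form_path\<close>): they are a flow of one unit from the first to the last node, and \<open>s\<close>
  increases along them, which excludes cycles. Diversion is possible only along selected arcs, and no
  goods may remain on an unselected arc. So the goods for each destination are forced along the
  route, where the amounts accumulate until the destination is reached. A request whose
  destination does not come later would have to be diverted up to the end of the route, where
  diversion is impossible. Hence the accepted requests are served by the route, the loads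
  are at most \<open>\<theta>\<close>, and the profit is at least the objective value
  (\<open>bpmp_solution_of_selected_route\<close>).

  As the BPMP has finitely many feasible solutions, its maximum is attained if there is any, and
  the two maps transfer it to the formulation and transfer optimal solutions back.
\<close>


section \<open>Sums and index sets\<close>

lemma sum_zero_one_eq_card:
  assumes "finite A" "\<And>k. k \<in> A \<Longrightarrow> f k \<in> {0, 1 :: real}"
  shows "sum f A = real (card {k \<in> A. f k = 1})"
proof -
  have "sum f A = (\<Sum>k\<in>A. if f k = 1 then 1 else 0)"
    by (rule sum.cong) (use assms(2) in auto)
  then show ?thesis using assms(1) by (simp flip: sum.inter_filter)
qed

lemma sum_single:
  assumes "finite A" and "\<And>k. k \<in> A \<Longrightarrow> k \<noteq> a \<Longrightarrow> f k = 0"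
  shows "sum f A = (if a \<in> A then f a else (0 :: real))"
proof -
  have "sum f A = (\<Sum>k\<in>A. if k = a then f a else 0)"
    by (rule sum.cong) (use assms(2) in auto)
  then show ?thesis using assms(1) by simp
qed

lemma finite_arc_set: "finite (arc_set I)"
  by (rule finite_subset[of _ "nodes I \<times> nodes I"]) (auto simp: arc_set_def nodes_def)

lemma finite_triples_sections:
  "finite {k. (k, i, j) \<in> triples I}" "finite {k. (i, k, j) \<in> triples I}"
  "finite {k. (i, j, k) \<in> triples I}"
  by (rule finite_subset[of _ "nodes I"]; force simp: triples_def nodes_def)+

lemma triples_feasibleD:
  assumes "triples_feasible I (x, y, \<theta>, u, s)"
  shows "(\<Sum>j = 2..num_nodes I. x 1 j) = 1"
    and "(\<Sum>i = 1..num_nodes I - 1. x i (num_nodes I)) = 1"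
    and "\<And>k. k \<in> nodes I - {1, num_nodes I} \<Longrightarrow>
          (\<Sum>i \<in> nodes I - {k, num_nodes I}. x i k) = (\<Sum>j \<in> nodes I - {1, k}. x k j)"
    and "(\<Sum>(i, j) \<in> arc_set I. distance I i j * x i j) \<le> distance_limit I"
    and "\<And>i j. (i, j) \<in> arc_set I \<Longrightarrow> s i - s j + (real (num_nodes I) + 1) * x i j \<le> real (num_nodes I)"
    and "\<And>i j. (i, j) \<in> arc_set I \<Longrightarrow> \<theta> i j \<le> capacity I * x i j"
    and "\<And>i j. (i, j) \<in> arc_set I \<Longrightarrow> \<theta> i j =
             (if (i, j) \<in> requests I then weight I i j * y i j else 0)
             + (\<Sum>k \<in> {k. (i, k, j) \<in> triples I}. u i k j)
             + (\<Sum>k \<in> {k. (k, j, i) \<in> triples I}. u k j i)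
             - (\<Sum>k \<in> {k. (i, j, k) \<in> triples I}. u i j k)"
    and "\<And>i j. (i, j) \<in> arc_set I \<Longrightarrow> \<theta> i j \<ge> 0"
    and "\<And>i j k. (i, j, k) \<in> triples I \<Longrightarrow> u i j k \<le> capacity I * x i k"
    and "\<And>i j k. (i, j, k) \<in> triples I \<Longrightarrow> u i j k \<ge> 0"
    and "\<And>i j. (i, j) \<in> arc_set I \<Longrightarrow> x i j \<in> {0, 1}"
    and "\<And>i j. (i, j) \<in> requests I \<Longrightarrow> y i j \<in> {0, 1}"
  using assms unfolding triples_feasible_def Let_def prod.case by blast+


section \<open>Paths in acyclic balanced arc sets\<close>

text \<open>
  An acyclic unit flow is a path: in a finite arc set with a potential that increases along
  arcs, the arc with the head of largest potential ends in a node without outgoing arcs. If \<open>a = b\<close>,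
  such a node contradicts the balance, so there are no arcs at all. Otherwise an arc \<open>(a, j)\<close>
  exists, and deleting it leaves an arc set that is balanced with the source moved to \<open>j\<close>.
  The increasing potential makes the path simple.
\<close>
lemma balanced_acyclic_is_path:
  fixes E :: "('a \<times> 'a) set" and pot :: "'a \<Rightarrow> real"
  assumes "finite E"
    and "\<And>i j. (i, j) \<in> E \<Longrightarrow> pot i < pot j"
    and "\<And>k. card {j. (k, j) \<in> E} + of_bool (k = b) = card {i. (i, k) \<in> E} + of_bool (k = a)"
    and "tail G = fst" and "head G = snd"
  shows "\<exists>p. set p = E \<and> pre_digraph.cas G a p b \<and>
             sorted_wrt (\<lambda>i j. pot i < pot j) (pre_digraph.awalk_verts G a p)"
  using assms
proof (induction "card E" arbitrary: E a)
  case 0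
  then have E: "E = {}"
    by simp
  with 0(4)[of a] have "a = b"
    by (simp add: of_bool_def split: if_splits)
  with E show ?case
    by (intro exI[of _ "[]"]) (simp add: pre_digraph.cas.simps pre_digraph.awalk_verts.simps)
next
  case (Suc m)
  note fin = Suc.prems(1) and pot = Suc.prems(2) and bal = Suc.prems(3)
  have fin_out: "finite {j. (k, j) \<in> E}" for k
    by (rule finite_subset[OF _ finite_imageI[OF fin, of snd]]) force
  have fin_in: "finite {i. (i, k) \<in> E}" for k
    by (rule finite_subset[OF _ finite_imageI[OF fin, of fst]]) force
  have "a \<noteq> b"
  proof
    assume "a = b"
    have "E \<noteq> {}" using Suc.hyps(2) by auto
    then have "Max ((pot \<circ> snd) ` E) \<in> (pot \<circ> snd) ` E"
      using fin by (intro Max_in) auto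
    then obtain e where e: "e \<in> E" and e_max: "pot (snd e) = Max ((pot \<circ> snd) ` E)"
      by auto
    obtain i k where ik: "e = (i, k)" by (cases e)
    with e have "card {i. (i, k) \<in> E} > 0"
      using fin_in[of k] by (auto simp: card_gt_0_iff)
    \<comment> \<open>An arc enters \<open>k\<close>, so by balance one leaves it, towards a node of larger potential.\<close>
    with bal[of k] \<open>a = b\<close> have "card {j. (k, j) \<in> E} > 0"
      by simp
    then obtain j where "(k, j) \<in> E"
      by (metis (no_types, lifting) Collect_empty_eq card.empty less_irrefl)
    then have "pot j \<le> Max ((pot \<circ> snd) ` E)" and "pot k < pot j"
      using fin pot by (auto intro!: Max_ge rev_image_eqI)
    with e_max ik show False by simp
  qed
  then have "card {j. (a, j) \<in> E} > 0"
    using bal[of a] by simp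
  then obtain j where j: "(a, j) \<in> E"
    by (metis (no_types, lifting) Collect_empty_eq card.empty less_irrefl)
  \<comment> \<open>Deleting \<open>(a, j)\<close> lowers the out-degree of \<open>a\<close> and the in-degree of \<open>j\<close>: the source moves to \<open>j\<close>.\<close>
  define E' where "E' = E - {(a, j)}"
  have out: "card {l. (k, l) \<in> E} = card {l. (k, l) \<in> E'} + of_bool (k = a)" for k
  proof (cases "k = a")
    case True
    then have "{l. (k, l) \<in> E} = insert j {l. (k, l) \<in> E'}" using j by (auto simp: E'_def)
    moreover have "finite {l. (k, l) \<in> E'}" "j \<notin> {l. (k, l) \<in> E'}"
      using fin_out[of k] True by (auto simp: E'_def intro: rev_finite_subset)
    ultimately show ?thesis using True by simp
  next
    case False
    then show ?thesis by (simp add: E'_def)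
  qed
  have inn: "card {l. (l, k) \<in> E} = card {l. (l, k) \<in> E'} + of_bool (k = j)" for k
  proof (cases "k = j")
    case True
    then have "{l. (l, k) \<in> E} = insert a {l. (l, k) \<in> E'}" using j by (auto simp: E'_def)
    moreover have "finite {l. (l, k) \<in> E'}" "a \<notin> {l. (l, k) \<in> E'}"
      using fin_in[of k] True by (auto simp: E'_def intro: rev_finite_subset)
    ultimately show ?thesis using True by simp
  next
    case False
    then show ?thesis by (simp add: E'_def)
  qed
  have "\<exists>p. set p = E' \<and> pre_digraph.cas G j p b \<and>
             sorted_wrt (\<lambda>i j. pot i < pot j) (pre_digraph.awalk_verts G j p)"
  proof (rule Suc.hyps(1))
    show "m = card E'" using Suc.hyps(2) fin j by (simp add: E'_def)
    show "finite E'" using fin by (simp add: E'_def)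
    show "pot i < pot k" if "(i, k) \<in> E'" for i k using that pot by (simp add: E'_def)
    show "card {l. (k, l) \<in> E'} + of_bool (k = b) = card {l. (l, k) \<in> E'} + of_bool (k = j)" for k
      using bal[of k] out[of k] inn[of k] by linarith
  qed (use Suc.prems in auto)
  then obtain p where p: "set p = E'" "pre_digraph.cas G j p b"
    "sorted_wrt (\<lambda>i j. pot i < pot j) (pre_digraph.awalk_verts G j p)"
    by blast
  obtain vs where vs: "pre_digraph.awalk_verts G j p = j # vs"
    using p(2) Suc.prems(4)
    by (cases p) (auto simp: pre_digraph.awalk_verts.simps pre_digraph.cas.simps)
  show ?case
  proof (intro exI[of _ "(a, j) # p"] conjI)
    show "set ((a, j) # p) = E" using p(1) j by (auto simp: E'_def)
    show "pre_digraph.cas G a ((a, j) # p) b"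
      using p(2) Suc.prems(4,5) by (simp add: pre_digraph.cas.simps)
    show "sorted_wrt (\<lambda>i j. pot i < pot j) (pre_digraph.awalk_verts G a ((a, j) # p))"
      using p(3) vs pot[OF j] Suc.prems(4,5)
      by (auto simp: pre_digraph.awalk_verts.simps)
  qed
qed


section \<open>Routes as sequences of nodes\<close>

text \<open>
  A route is handled through the function \<open>v\<close> that gives its node at each position, so that
  the order of visits and the extent of a part of the route become inequalities between positions.
\<close>
definition path_arcs :: "(nat \<Rightarrow> nat) \<Rightarrow> nat \<Rightarrow> nat \<Rightarrow> (nat \<times> nat) list" where
  "path_arcs v a b = map (\<lambda>c. (v c, v (Suc c))) [a..<b]"

lemma set_path_arcs: "set (path_arcs v a b) = (\<lambda>c. (v c, v (Suc c))) ` {a..<b}"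
  by (simp add: path_arcs_def)

lemma cas_path_arcs:
  assumes "a \<le> b"
  shows "pre_digraph.cas (bpmp_graph I) i (path_arcs v a b) j \<longleftrightarrow>
           (if a = b then i = j else i = v a \<and> j = v b)"
  using assms
proof (induction "b - a" arbitrary: a i)
  case 0
  then show ?case by (simp add: path_arcs_def pre_digraph.cas.simps)
next
  case (Suc d)
  then have "path_arcs v a b = (v a, v (Suc a)) # path_arcs v (Suc a) b"
    by (simp add: path_arcs_def upt_conv_Cons)
  moreover have "pre_digraph.cas (bpmp_graph I) (v (Suc a)) (path_arcs v (Suc a) b) j \<longleftrightarrow> j = v b"
    using Suc.hyps(1)[of "Suc a" "v (Suc a)"] Suc.hyps(2) Suc.prems by auto
  ultimately show ?case using Suc by (auto simp: pre_digraph.cas.simps bpmp_graph_def)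
qed

lemma awalk_verts_path_arcs:
  assumes "a \<le> b"
  shows "pre_digraph.awalk_verts (bpmp_graph I) (v a) (path_arcs v a b) = map v [a..<Suc b]"
  using assms
proof (induction "b - a" arbitrary: a)
  case 0
  then show ?case by (simp add: path_arcs_def pre_digraph.awalk_verts.simps)
next
  case (Suc d)
  then have "path_arcs v a b = (v a, v (Suc a)) # path_arcs v (Suc a) b"
    by (simp add: path_arcs_def upt_conv_Cons)
  moreover have "pre_digraph.awalk_verts (bpmp_graph I) (v (Suc a)) (path_arcs v (Suc a) b)
      = map v [Suc a..<Suc b]"
    using Suc.hyps(1)[of "Suc a"] Suc.hyps(2) Suc.prems by auto
  moreover have "[a..<Suc b] = a # [Suc a..<Suc b]"
    using Suc.hyps(2) by (simp add: upt_conv_Cons del: upt_Suc)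
  ultimately show ?case using Suc
    by (auto simp: pre_digraph.awalk_verts.simps bpmp_graph_def simp del: upt_Suc)
qed

lemma cas_eq_path_arcs:
  assumes "pre_digraph.cas (bpmp_graph I) i P j"
  shows "P = path_arcs ((!) (pre_digraph.awalk_verts (bpmp_graph I) i P)) 0 (length P)"
  using assms
proof (induction P arbitrary: i)
  case Nil
  then show ?case by (simp add: path_arcs_def)
next
  case (Cons e P)
  let ?V = "pre_digraph.awalk_verts (bpmp_graph I)"
  obtain i' k where e: "e = (i', k)" by (cases e)
  from Cons.prems e have i: "i' = i" and cas: "pre_digraph.cas (bpmp_graph I) k P j"
    by (auto simp: pre_digraph.cas.simps bpmp_graph_def)
  have verts: "?V i (e # P) = i # ?V k P"
    using e i by (simp add: pre_digraph.awalk_verts.simps bpmp_graph_def)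
  have hd: "?V k P ! 0 = k"
    using cas by (cases P) (auto simp: pre_digraph.awalk_verts.simps pre_digraph.cas.simps)
  have "path_arcs ((!) (i # ?V k P)) 0 (Suc (length P))
      = (i, k) # path_arcs ((!) (?V k P)) 0 (length P)"
    unfolding path_arcs_def
    using hd by (simp add: upt_conv_Cons map_Suc_upt[symmetric] o_def del: upt_Suc map_Suc_upt)
  then show ?case using Cons.IH[OF cas] e i verts by simp
qed

text \<open>
  Simplicity is the injectivity of \<open>v\<close> on the positions up to \<open>m\<close>, the number of arcs.
\<close>
locale route =
  fixes I :: bpmp and v :: "nat \<Rightarrow> nat" and m :: nat
  assumes inst: "bpmp_instance I"
    and inj: "inj_on v {..m}"
    and first: "v 0 = 1" and last: "v m = num_nodes I"
    and in_nodes: "\<And>c. c \<le> m \<Longrightarrow> v c \<in> nodes I"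
begin

abbreviation "n \<equiv> num_nodes I"
abbreviation "P \<equiv> path_arcs v 0 m"

lemma n_ge_2: "n \<ge> 2"
  using inst by (simp add: bpmp_instance_def)

lemma m_pos: "m > 0"
  using n_ge_2 first last by (cases m) auto

lemma v_eq_iff: "a \<le> m \<Longrightarrow> b \<le> m \<Longrightarrow> v a = v b \<longleftrightarrow> a = b"
  using inj by (auto simp: inj_on_def)

lemma v_eq_last_iff: "a \<le> m \<Longrightarrow> v a = n \<longleftrightarrow> a = m"
  using v_eq_iff[of a m] last by simp

lemma v_eq_first_iff: "a \<le> m \<Longrightarrow> v a = Suc 0 \<longleftrightarrow> a = 0"
  using v_eq_iff[of a 0] first by simp

lemma arc_between:
  assumes "a < m" "b \<le> m" "b > 0" "a \<noteq> b"
  shows "(v a, v b) \<in> arc_set I"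
  using assms in_nodes[of a] in_nodes[of b] v_eq_last_iff[of a] v_eq_first_iff[of b] v_eq_iff[of a b]
  by (auto simp: arc_set_def nodes_def)

lemma set_P_subset: "set P \<subseteq> arc_set I"
  by (auto simp: set_path_arcs intro: arc_between)

lemma apath: "pre_digraph.apath (bpmp_graph I) 1 P n"
proof -
  have "distinct (pre_digraph.awalk_verts (bpmp_graph I) 1 P)"
    using awalk_verts_path_arcs[of 0 m I v] first inj
    by (simp add: distinct_map atLeast0LessThan lessThan_Suc_atMost del: upt_Suc)
  moreover have "pre_digraph.cas (bpmp_graph I) 1 P n"
    using cas_path_arcs[of 0 m I 1 v n] first last m_pos by simp
  moreover have "1 \<in> verts (bpmp_graph I)"
    using in_nodes[of 0] first by (simp add: bpmp_graph_def)
  moreover have "set P \<subseteq> arcs (bpmp_graph I)"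
    using set_P_subset by (simp add: bpmp_graph_def)
  ultimately show ?thesis
    by (simp add: pre_digraph.apath_def pre_digraph.awalk_def)
qed

text \<open>
  A contiguous sublist of the arcs of the route is given by its first and its last position.
\<close>
lemma route_part_iff:
  "route_part I P k l q \<longleftrightarrow> (\<exists>a b. a < b \<and> b \<le> m \<and> k = v a \<and> l = v b \<and> q = path_arcs v a b)"
proof
  assume "route_part I P k l q"
  then obtain xs zs where P: "P = xs @ q @ zs" and "q \<noteq> []"
    and cas: "pre_digraph.cas (bpmp_graph I) k q l"
    by (auto simp: route_part_def sublist_def pre_digraph.awalk_def)
  let ?a = "length xs" and ?b = "length xs + length q"
  have "length P = m" by (simp add: path_arcs_def)
  then have len: "?b \<le> m" using P by simp
  have "q = take (length q) (drop ?a P)" using P by simp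
  also have "\<dots> = path_arcs v ?a ?b"
    using len by (simp add: path_arcs_def take_map drop_map take_upt)
  finally have q: "q = path_arcs v ?a ?b" .
  have "?a < ?b" using \<open>q \<noteq> []\<close> by simp
  moreover have "k = v ?a \<and> l = v ?b"
    using cas q cas_path_arcs[of ?a ?b I k v l] \<open>?a < ?b\<close> by simp
  ultimately show "\<exists>a b. a < b \<and> b \<le> m \<and> k = v a \<and> l = v b \<and> q = path_arcs v a b"
    using len q by blast
next
  assume "\<exists>a b. a < b \<and> b \<le> m \<and> k = v a \<and> l = v b \<and> q = path_arcs v a b"
  then obtain a b where ab: "a < b" "b \<le> m" "k = v a" "l = v b" "q = path_arcs v a b"
    by blast
  have "[0..<m] = [0..<a] @ [a..<b] @ [b..<m]"
    using ab(1,2) by (metis append.assoc le_add_diff_inverse less_imp_le_nat upt_add_eq_append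
      zero_le)
  then have "P = path_arcs v 0 a @ q @ path_arcs v b m"
    using ab(5) by (simp add: path_arcs_def flip: map_append)
  then have "sublist q P" unfolding sublist_def by blast
  moreover have "q \<noteq> []" using ab by (simp add: path_arcs_def)
  moreover have "k \<in> verts (bpmp_graph I)" using ab in_nodes by (simp add: bpmp_graph_def)
  moreover have "set q \<subseteq> arcs (bpmp_graph I)"
    using \<open>sublist q P\<close> set_P_subset by (auto simp: bpmp_graph_def dest: set_mono_sublist)
  moreover have "pre_digraph.cas (bpmp_graph I) k q l"
    using ab cas_path_arcs[of a b I k v l] by simp
  ultimately show "route_part I P k l q"
    by (simp add: route_part_def pre_digraph.awalk_def)
qed

lemma served_iff: "(\<exists>q. route_part I P k l q) \<longleftrightarrow> (\<exists>a b. a < b \<and> b \<le> m \<and> k = v a \<and> l = v b)"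
  by (auto simp: route_part_iff)

text \<open>
  While \<open>j\<close> lies ahead of position \<open>c\<close>, all requests for \<open>j\<close> that were picked up at a position
  \<open>a \<le> c\<close> are still on board. Hence \<open>carried S c j\<close> is the part of the load on the arc leaving
  \<open>v c\<close> that is destined for \<open>j\<close>. For nodes \<open>j\<close> already passed it has no meaning.
\<close>
definition carried :: "(nat \<times> nat) set \<Rightarrow> nat \<Rightarrow> nat \<Rightarrow> real" where
  "carried S c j = (\<Sum>a\<le>c. if (v a, j) \<in> S then weight I (v a) j else 0)"

text \<open>
  The requests on board between positions \<open>c\<close> and \<open>Suc c\<close> are those from a position \<open>a \<le> c\<close> to a
  position \<open>b \<ge> Suc c\<close>; grouping them by destination gives the sum.
\<close>
lemma load_eq_carried:
  assumes "c < m" "finite S"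
  shows "load I P S (v c) (v (Suc c)) = (\<Sum>b = Suc c..m. carried S c (v b))"
proof -
  let ?B = "{..c} \<times> {Suc c..m}"
  let ?r = "\<lambda>(a, b). (v a, v b)"
  let ?U = "{(a, b) \<in> ?B. (v a, v b) \<in> S}"
  have "(\<exists>q. route_part I P k l q \<and> (v c, v (Suc c)) \<in> set q) \<longleftrightarrow> (k, l) \<in> ?r ` ?B" for k l
  proof
    assume "\<exists>q. route_part I P k l q \<and> (v c, v (Suc c)) \<in> set q"
    then obtain a b where "a < b" "b \<le> m" "k = v a" "l = v b" "(v c, v (Suc c)) \<in> set (path_arcs v a b)"
      by (auto simp: route_part_iff)
    moreover from this obtain c' where "v c' = v c" "a \<le> c'" "c' < b"
      by (auto simp: set_path_arcs)
    moreover have "c' = c" using calculation assms v_eq_iff by auto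
    ultimately show "(k, l) \<in> ?r ` ?B"
      by (intro image_eqI[of _ _ "(a, b)"]) auto
  next
    assume "(k, l) \<in> ?r ` ?B"
    then obtain a b where "a \<le> c" "Suc c \<le> b" "b \<le> m" "k = v a" "l = v b" by auto
    then show "\<exists>q. route_part I P k l q \<and> (v c, v (Suc c)) \<in> set q"
      unfolding route_part_iff
      by (intro exI[of _ "path_arcs v a b"] conjI exI[of _ a] exI[of _ b])
        (auto simp: set_path_arcs)
  qed
  then have "{(k, l) \<in> S. \<exists>q. route_part I P k l q \<and> (v c, v (Suc c)) \<in> set q} = ?r ` ?U"
    by auto
  then have "load I P S (v c) (v (Suc c)) = (\<Sum>(k, l) \<in> ?r ` ?U. weight I k l)"
    unfolding load_def by simp
  also have "\<dots> = (\<Sum>(a, b) \<in> ?U. weight I (v a) (v b))"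
  proof (subst sum.reindex)
    show "inj_on ?r ?U"
      using assms by (auto simp: inj_on_def v_eq_iff)
  qed (simp add: case_prod_unfold)
  also have "\<dots> = (\<Sum>(a, b) \<in> ?B. if (v a, v b) \<in> S then weight I (v a) (v b) else 0)"
    by (rule sum.mono_neutral_cong_left) (auto split: if_splits)
  also have "\<dots> = (\<Sum>a\<le>c. \<Sum>b = Suc c..m. if (v a, v b) \<in> S then weight I (v a) (v b) else 0)"
    by (simp add: sum.cartesian_product)
  also have "\<dots> = (\<Sum>b = Suc c..m. carried S c (v b))"
    unfolding carried_def by (rule sum.swap)
  finally show ?thesis .
qed

end

lemma apath_imp_route:
  assumes inst: "bpmp_instance I" and apath: "pre_digraph.apath (bpmp_graph I) 1 P (num_nodes I)"
  obtains v m where "route I v m" "P = path_arcs v 0 m"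
proof
  let ?vs = "pre_digraph.awalk_verts (bpmp_graph I) 1 P"
  let ?v = "(!) ?vs"
  interpret wf_digraph "bpmp_graph I"
    by standard (auto simp: bpmp_graph_def arc_set_def)
  have awalk: "awalk 1 P (num_nodes I)" and "distinct ?vs"
    using apath by (auto simp: apath_def)
  show "P = path_arcs ?v 0 (length P)"
    using awalk by (intro cas_eq_path_arcs) (auto simp: awalk_def)
  have len: "length ?vs = Suc (length P)" by (rule length_awalk_verts)
  show "route I ?v (length P)"
  proof
    show "bpmp_instance I" by fact
    show "inj_on ?v {..length P}"
      using \<open>distinct ?vs\<close> len by (simp add: inj_on_def nth_eq_iff_index_eq)
    show "?v 0 = 1"
      using awalkE[OF awalk] hd_conv_nth[OF awalk_verts_non_Nil] by metis
    show "?v (length P) = num_nodes I"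
      using awalkE[OF awalk] last_conv_nth[OF awalk_verts_non_Nil] len by (metis diff_Suc_1)
    show "?v c \<in> nodes I" if "c \<le> length P" for c
    proof -
      have "?v c \<in> set ?vs" using that len by simp
      then show ?thesis using awalkE[OF awalk] by (auto simp: bpmp_graph_def)
    qed
  qed
qed


section \<open>From routes to the triples formulation\<close>

context route
begin

lemma requests_subset: "requests I \<subseteq> arc_set I"
  using inst by (simp add: bpmp_instance_def)

lemma finite_requests: "finite (requests I)"
  using requests_subset finite_arc_set finite_subset by blast

lemma weight_pos: "(i, j) \<in> requests I \<Longrightarrow> weight I i j > 0"
  using inst by (auto simp: bpmp_instance_def)

lemma Q_nonneg: "capacity I \<ge> 0"
  using inst by (simp add: bpmp_instance_def)

lemma arc_in_P_iff:
  "c \<le> m \<Longrightarrow> (v c, j) \<in> set P \<longleftrightarrow> c < m \<and> j = v (Suc c)"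
  "c < m \<Longrightarrow> (i, v (Suc c)) \<in> set P \<longleftrightarrow> i = v c"
  by (force simp: set_path_arcs v_eq_iff)+

lemma arc_in_P_dest:
  "(i, j) \<in> set P \<Longrightarrow> i \<in> v ` {..<m}"
  "(i, j) \<in> set P \<Longrightarrow> j \<in> v ` {0<..m}"
  by (auto simp: set_path_arcs)

lemma carried_Suc:
  "carried S (Suc c) j = carried S c j + (if (v (Suc c), j) \<in> S then weight I (v (Suc c)) j else 0)"
  by (simp add: carried_def)

lemma carried_nonneg: "S \<subseteq> requests I \<Longrightarrow> carried S c j \<ge> 0"
  unfolding carried_def by (intro sum_nonneg) (auto intro: less_imp_le[OF weight_pos])

text \<open>
  The values of the variables \<open>u\<close> for a route: what is at \<open>v c\<close> on its way to a node \<open>j\<close> beyond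
  \<open>v (Suc c)\<close> is diverted from the direct arc \<open>(v c, j)\<close> through the next node of the route. For given
  \<open>i\<close>, \<open>j\<close>, \<open>k\<close> at most one summand is nonzero, since \<open>v\<close> is injective; a sum spares the choice of the
  position of \<open>i\<close>.
\<close>
definition diverted :: "(nat \<times> nat) set \<Rightarrow> nat \<Rightarrow> nat \<Rightarrow> nat \<Rightarrow> real" where
  "diverted S i j k =
     (\<Sum>c<m. if i = v c \<and> k = v (Suc c) \<and> j \<in> v ` {Suc c<..m} then carried S c j else 0)"

lemma diverted_at:
  assumes "c < m"
  shows "diverted S (v c) j k =
    (if k = v (Suc c) \<and> j \<in> v ` {Suc c<..m} then carried S c j else 0)"
proof -
  have "diverted S (v c) j k = (\<Sum>c'<m. if c' = c then
    (if k = v (Suc c) \<and> j \<in> v ` {Suc c<..m} then carried S c j else 0) else 0)"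
    unfolding diverted_def using assms by (intro sum.cong) (auto simp: v_eq_iff)
  then show ?thesis using assms by simp
qed

lemma diverted_into:
  assumes "c < m"
  shows "diverted S i j (v (Suc c)) =
    (if i = v c \<and> j \<in> v ` {Suc c<..m} then carried S c j else 0)"
proof -
  have "diverted S i j (v (Suc c)) = (\<Sum>c'<m. if c' = c then
    (if i = v c \<and> j \<in> v ` {Suc c<..m} then carried S c j else 0) else 0)"
    unfolding diverted_def using assms by (intro sum.cong) (auto simp: v_eq_iff)
  then show ?thesis using assms by simp
qed

lemma diverted_off_route:
  "i \<notin> v ` {..<m} \<Longrightarrow> diverted S i j k = 0"
  "k \<notin> v ` {0<..m} \<Longrightarrow> diverted S i j k = 0"
  unfolding diverted_def by (intro sum.neutral; auto)+

text \<open>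
  The values of the variables \<open>s\<close>. Nodes off the route have no selected arcs, so for them any value
  between \<open>0\<close> and \<open>n\<close> satisfies the constraints on \<open>s\<close>.
\<close>
definition position :: "nat \<Rightarrow> real" where
  "position i = (if i \<in> v ` {..m} then real (the_inv_into {..m} v i) else 0)"

lemma position_at: "c \<le> m \<Longrightarrow> position (v c) = real c"
  using inj by (simp add: position_def the_inv_into_f_f)

lemma m_less_n: "m < n"
proof -
  have "v ` {..m} \<subseteq> nodes I" using in_nodes by auto
  then have "card (v ` {..m}) \<le> card (nodes I)" by (intro card_mono) (auto simp: nodes_def)
  then show ?thesis using inj by (simp add: card_image nodes_def)
qed

lemma position_bounds: "0 \<le> position i" "position i \<le> real n"
proof -
  have "0 \<le> position i \<and> position i \<le> real n"
  proof (cases "i \<in> v ` {..m}")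
    case True
    then show ?thesis using position_at m_less_n by force
  qed (simp add: position_def)
  then show "0 \<le> position i" "position i \<le> real n" by auto
qed

lemma sum_arc_set_indicator:
  "(\<Sum>(i, j)\<in>arc_set I. f i j * of_bool ((i, j) \<in> set P)) = (\<Sum>(i, j)\<in>set P. f i j :: real)"
  by (rule sum.mono_neutral_cong_right[OF finite_arc_set]) (use set_P_subset in auto)

text \<open>
  If \<open>i\<close> is off the route, all terms are \<open>0\<close>. For \<open>i = v c\<close> the constraint accounts for the goods at \<open>i\<close> destined for
  \<open>j\<close>. Those accepted at \<open>i\<close> and those diverted into \<open>i\<close> from its predecessor add up to \<open>carried S c j\<close>
  if \<open>j\<close> lies ahead, and to \<open>0\<close> otherwise. If \<open>j\<close> is not the next node, they are all diverted again,
  and the arc carries nothing. If \<open>j\<close> is the next node, they travel along \<open>(i, j)\<close> together with the goods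
  for all later destinations, which are diverted from the arcs \<open>(i, k)\<close> through \<open>j\<close>; by
  \<open>load_eq_carried\<close> the total is the load.
\<close>
lemma diverted_balance:
  assumes "(i, j) \<in> arc_set I" and S: "S \<subseteq> requests I"
    and served: "\<And>k l. (k, l) \<in> S \<Longrightarrow> \<exists>q. route_part I P k l q"
  shows "of_bool ((i, j) \<in> set P) * load I P S i j =
      (if (i, j) \<in> requests I then weight I i j * of_bool ((i, j) \<in> S) else 0)
      + (\<Sum>k \<in> {k. (i, k, j) \<in> triples I}. diverted S i k j)
      + (\<Sum>k \<in> {k. (k, j, i) \<in> triples I}. diverted S k j i)
      - (\<Sum>k \<in> {k. (i, j, k) \<in> triples I}. diverted S i j k)"
proof -
  have S_later: "j \<in> v ` {c<..m}" if "(v c, j) \<in> S" "c \<le> m" for c j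
    using served[OF that(1)] that(2) by (auto simp: served_iff v_eq_iff)
  have finS: "finite S" using S finite_requests finite_subset by blast
  have wy: "(if (i, j) \<in> requests I then weight I i j * of_bool ((i, j) \<in> S) else 0)
      = (if (i, j) \<in> S then weight I i j else 0)"
    using S by auto
  have ij: "i \<in> nodes I" "j \<in> nodes I" "i \<noteq> n" "j \<noteq> Suc 0" "i \<noteq> j"
    using assms(1) by (auto simp: arc_set_def)
  show ?thesis
  proof (cases "i \<in> v ` {..<m}")
    case False
    have "diverted S k j i = 0" for k
    proof (cases "i \<in> v ` {0<..m}")
      case True
      then obtain c where c: "0 < c" "c \<le> m" "i = v c" by auto
      with False have "c = m" by (cases "c = m") auto
      with c ij show ?thesis by (simp add: last)
    qed (simp add: diverted_off_route)
    moreover have "(i, j) \<notin> S"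
      using served[of i j] False by (force simp: served_iff)
    moreover have "(i, j) \<notin> set P" using False arc_in_P_dest by blast
    ultimately show ?thesis
      using False by (simp add: wy diverted_off_route)
  next
    case True
    then obtain c where c: "c < m" "i = v c" by auto
    have inflow: "(\<Sum>k \<in> {k. (k, j, i) \<in> triples I}. diverted S k j i)
      = (if j \<in> v ` {c<..m} then carried S c j - (if (i, j) \<in> S then weight I i j else 0) else 0)"
    proof (cases c)
      case 0
      then have "{k. (k, j, i) \<in> triples I} = {}"
        using c first by (auto simp: triples_def)
      then show ?thesis using 0 c by (simp only: sum.empty) (simp add: carried_def)
    next
      case (Suc c')
      have "(\<Sum>k \<in> {k. (k, j, i) \<in> triples I}. diverted S k j i)
        = (if v c' \<in> {k. (k, j, i) \<in> triples I} then diverted S (v c') j i else 0)"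
        by (rule sum_single) (use Suc c finite_triples_sections in \<open>auto simp: diverted_into\<close>)
      moreover have "v c' \<in> {k. (k, j, i) \<in> triples I}" if "j \<in> v ` {c<..m}"
        using that ij c Suc in_nodes[of c']
        by (auto simp: triples_def v_eq_iff v_eq_last_iff v_eq_first_iff)
      ultimately show ?thesis using c Suc carried_Suc[of S c' j]
        by (auto simp: diverted_into)
    qed
    have "(\<Sum>k \<in> {k. (i, j, k) \<in> triples I}. diverted S i j k)
      = (if v (Suc c) \<in> {k. (i, j, k) \<in> triples I} then diverted S i j (v (Suc c)) else 0)"
      by (rule sum_single) (use c finite_triples_sections in \<open>auto simp: diverted_at\<close>)
    moreover have "v (Suc c) \<in> {k. (i, j, k) \<in> triples I}" if "j \<in> v ` {Suc c<..m}"
      using that ij c in_nodes[of "Suc c"]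
      by (auto simp: triples_def v_eq_iff v_eq_last_iff v_eq_first_iff)
    ultimately have outflow: "(\<Sum>k \<in> {k. (i, j, k) \<in> triples I}. diverted S i j k)
      = (if j \<in> v ` {Suc c<..m} then carried S c j else 0)"
      using c by (auto simp: diverted_at)
    show ?thesis
    proof (cases "j = v (Suc c)")
      case True
      have sub: "v ` {Suc c<..m} \<subseteq> {k. (i, k, j) \<in> triples I}"
        using ij c True in_nodes
        by (auto simp: triples_def v_eq_iff v_eq_last_iff v_eq_first_iff)
      have "(\<Sum>k \<in> {k. (i, k, j) \<in> triples I}. diverted S i k j)
        = (\<Sum>k \<in> v ` {Suc c<..m}. carried S c k)"
        using c True
        by (intro sum.mono_neutral_cong_right finite_triples_sections sub)
          (auto simp: diverted_at)
      also have "\<dots> = (\<Sum>b \<in> {Suc c<..m}. carried S c (v b))"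
        by (subst sum.reindex) (auto intro: inj_on_subset[OF inj])
      finally have through: "(\<Sum>k \<in> {k. (i, k, j) \<in> triples I}. diverted S i k j)
        = (\<Sum>b \<in> {Suc c<..m}. carried S c (v b))" .
      have "load I P S i j = (\<Sum>b = Suc c..m. carried S c (v b))"
        using load_eq_carried[OF c(1) finS] c True by simp
      also have "\<dots> = carried S c j + (\<Sum>b \<in> {Suc c<..m}. carried S c (v b))"
        using c True by (simp add: sum.head)
      finally show ?thesis
        unfolding wy using c True arc_in_P_iff(1)[of c j] through inflow outflow
        by (auto simp: v_eq_iff)
    next
      case False
      then have "(\<Sum>k \<in> {k. (i, k, j) \<in> triples I}. diverted S i k j) = 0"
        using c by (intro sum.neutral) (auto simp: diverted_at)
      moreover have "(i, j) \<notin> set P" using False c arc_in_P_iff(1)[of c j] by auto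
      moreover have "j \<in> v ` {c<..m} \<longleftrightarrow> j \<in> v ` {Suc c<..m}"
        using False by (auto simp: image_iff) (metis Suc_lessI greaterThanAtMost_iff)
      moreover have "(i, j) \<notin> S" if "j \<notin> v ` {c<..m}"
        using that S_later c by auto
      ultimately show ?thesis
        unfolding wy using inflow outflow by auto
    qed
  qed
qed

lemma carried_le_load:
  assumes "S \<subseteq> requests I" "c < m" "j \<in> v ` {c<..m}"
  shows "carried S c j \<le> load I P S (v c) (v (Suc c))"
proof -
  from assms(3) obtain b where b: "Suc c \<le> b" "b \<le> m" "j = v b"
    by (auto simp: less_eq_Suc_le)
  have "carried S c (v b) \<le> (\<Sum>b = Suc c..m. carried S c (v b))"
    using b carried_nonneg[OF assms(1)] by (intro member_le_sum) auto
  then show ?thesis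
    using b load_eq_carried[OF assms(2)] assms(1) finite_requests finite_subset by metis
qed

lemma load_nonneg: "S \<subseteq> requests I \<Longrightarrow> load I P S i j \<ge> 0"
  unfolding load_def by (intro sum_nonneg) (auto intro: less_imp_le[OF weight_pos])

text \<open>
  The balance is \<open>diverted_balance\<close>, each diverted amount is part of the load on an arc of the route
  and so respects the capacity, and along the route the positions increase by \<open>1\<close>. The objective
  value is the profit because \<open>\<theta>\<close> is the load on the route and \<open>0\<close> elsewhere.
\<close>
lemma triples_solution_of_route:
  assumes feas: "bpmp_feasible I (P, S)"
  defines "x \<equiv> \<lambda>i j. of_bool ((i, j) \<in> set P)"
    and "y \<equiv> \<lambda>i j. of_bool ((i, j) \<in> S)"
    and "\<theta> \<equiv> \<lambda>i j. of_bool ((i, j) \<in> set P) * load I P S i j"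
  shows "triples_feasible I (x, y, \<theta>, diverted S, position)" (is ?feas)
    and "triples_objective I (x, y, \<theta>, diverted S, position) = bpmp_profit I (P, S)" (is ?obj)
proof -
  from feas have S: "S \<subseteq> requests I"
    and served: "\<And>k l. (k, l) \<in> S \<Longrightarrow> \<exists>q. route_part I P k l q"
    and cap: "\<And>i j. (i, j) \<in> set P \<Longrightarrow> load I P S i j \<le> capacity I"
    and dist: "(\<Sum>(i, j) \<in> set P. distance I i j) \<le> distance_limit I"
    by auto
  show ?feas
    unfolding triples_feasible_def Let_def prod.case
  proof (intro conjI)
    have "x 1 j = (if j = v 1 then 1 else 0)" for j
      using arc_in_P_iff(1)[of 0 j] m_pos first by (simp add: x_def)
    moreover have "v 1 \<in> {2..n}"
      using in_nodes[of 1] m_pos v_eq_first_iff[of 1] by (auto simp: nodes_def)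
    ultimately show "(\<Sum>j = 2..n. x 1 j) = 1" by simp
    obtain m' where m': "m = Suc m'" using m_pos by (cases m) auto
    then have "x i n = (if i = v m' then 1 else 0)" for i
      using arc_in_P_iff(2)[of m' i] last by (simp add: x_def)
    moreover have "v m' \<in> {1..n - 1}"
      using in_nodes[of m'] m' v_eq_last_iff[of m'] by (auto simp: nodes_def)
    ultimately show "(\<Sum>i = 1..n - 1. x i n) = 1" by simp
    show "\<forall>k\<in>nodes I - {1, n}. (\<Sum>i\<in>nodes I - {k, n}. x i k) = (\<Sum>j\<in>nodes I - {1, k}. x k j)"
    proof
      fix k assume k: "k \<in> nodes I - {1, n}"
      have fin: "finite (nodes I)" by (simp add: nodes_def)
      show "(\<Sum>i\<in>nodes I - {k, n}. x i k) = (\<Sum>j\<in>nodes I - {1, k}. x k j)"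
      proof (cases "k \<in> v ` {..m}")
        case True
        then obtain c where c: "c \<le> m" "k = v c" by auto
        with k have "c \<noteq> 0" "c \<noteq> m" using v_eq_first_iff[of c] v_eq_last_iff[of c] by auto
        then obtain c' where c': "c = Suc c'" by (cases c) auto
        have "x i k = (if i = v c' then 1 else 0)" for i
          using arc_in_P_iff(2)[of c' i] c c' by (simp add: x_def)
        moreover have "x k j = (if j = v (Suc c) then 1 else 0)" for j
          using arc_in_P_iff(1)[of c j] c \<open>c \<noteq> m\<close> by (simp add: x_def)
        moreover have "v c' \<in> nodes I - {k, n}" "v (Suc c) \<in> nodes I - {1, k}"
          using in_nodes[of c'] in_nodes[of "Suc c"] c c' \<open>c \<noteq> m\<close>
          by (auto simp: v_eq_iff v_eq_last_iff v_eq_first_iff)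
        ultimately show ?thesis using fin by simp
      next
        case False
        then have "x i k = 0" "x k i = 0" for i
          using arc_in_P_dest[of i k] arc_in_P_dest[of k i] by (auto simp: x_def)
        then show ?thesis by simp
      qed
    qed
    show "(\<Sum>(i, j)\<in>arc_set I. distance I i j * x i j) \<le> distance_limit I"
      using dist sum_arc_set_indicator[of "distance I"] by (simp add: x_def)
    show "\<forall>(i, j)\<in>arc_set I. position i - position j + (real n + 1) * x i j \<le> real n"
    proof safe
      fix i j
      show "position i - position j + (real n + 1) * x i j \<le> real n"
      proof (cases "(i, j) \<in> set P")
        case True
        then obtain c where "c < m" "i = v c" "j = v (Suc c)" by (auto simp: set_path_arcs)
        then show ?thesis using True by (simp add: x_def position_at)
      next
        case False
        then show ?thesis using position_bounds(2)[of i] position_bounds(1)[of j]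
          by (simp add: x_def)
      qed
    qed
    show "\<forall>i\<in>nodes I. 0 \<le> position i" using position_bounds by simp
    show "\<forall>(i, j)\<in>arc_set I. \<theta> i j \<le> capacity I * x i j"
      using cap by (auto simp: \<theta>_def x_def)
    show "\<forall>(i, j)\<in>arc_set I. \<theta> i j =
       (if (i, j) \<in> requests I then weight I i j * y i j else 0) +
       (\<Sum>k\<in>{k. (i, k, j) \<in> triples I}. diverted S i k j) +
       (\<Sum>k\<in>{k. (k, j, i) \<in> triples I}. diverted S k j i) -
       (\<Sum>k\<in>{k. (i, j, k) \<in> triples I}. diverted S i j k)"
      unfolding \<theta>_def y_def using diverted_balance[OF _ S served] by blast
    show "\<forall>(i, j)\<in>arc_set I. 0 \<le> \<theta> i j"
      using load_nonneg[OF S] by (simp add: \<theta>_def split_def)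
    show "\<forall>(i, j, k)\<in>triples I. diverted S i j k \<le> capacity I * x i k \<and> 0 \<le> diverted S i j k"
    proof safe
      fix i j k
      show "0 \<le> diverted S i j k"
        unfolding diverted_def by (intro sum_nonneg) (auto intro: carried_nonneg[OF S])
      show "diverted S i j k \<le> capacity I * x i k"
      proof (cases "\<exists>c<m. i = v c \<and> k = v (Suc c) \<and> j \<in> v ` {Suc c<..m}")
        case True
        then obtain c where c: "c < m" "i = v c" "k = v (Suc c)" "j \<in> v ` {Suc c<..m}" by blast
        then have "j \<in> v ` {c<..m}" by auto
        then have "carried S c j \<le> capacity I"
          using carried_le_load[OF S c(1), of j] cap[of i k] c arc_in_P_iff(1)[of c k] by force
        then show ?thesis
          using c arc_in_P_iff(1)[of c k] by (simp add: diverted_at x_def)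
      next
        case False
        then have "diverted S i j k = 0"
          unfolding diverted_def by (intro sum.neutral) auto
        then show ?thesis using Q_nonneg by (simp add: x_def)
      qed
    qed
    show "\<forall>(i, j)\<in>arc_set I. x i j \<in> {0, 1}" "\<forall>(i, j)\<in>requests I. y i j \<in> {0, 1}"
      by (auto simp: x_def y_def)
  qed
  have "(\<Sum>(k, l)\<in>requests I. distance I k l * weight I k l * y k l)
      = (\<Sum>(k, l)\<in>S. distance I k l * weight I k l)"
    by (rule sum.mono_neutral_cong_right[OF finite_requests S]) (auto simp: y_def)
  moreover have "(\<Sum>(i, j)\<in>arc_set I. distance I i j * \<theta> i j)
      = (\<Sum>(i, j)\<in>set P. distance I i j * load I P S i j)"
    using sum_arc_set_indicator[of "\<lambda>i j. distance I i j * load I P S i j"]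
    by (simp add: \<theta>_def mult_ac)
  moreover have "(\<Sum>(i, j)\<in>arc_set I. distance I i j * x i j) = (\<Sum>(i, j)\<in>set P. distance I i j)"
    using sum_arc_set_indicator[of "distance I"] by (simp add: x_def)
  ultimately show ?obj by simp
qed

end


section \<open>From the triples formulation to routes\<close>

text \<open>
  For a selected arc the constraint on \<open>s\<close> reads \<open>s i + 1 \<le> s j\<close>, so \<open>s\<close> is a potential that excludes
  subtours. The degree constraints say that the selected arcs carry one unit from \<open>1\<close> to \<open>n\<close>,
  and \<open>balanced_acyclic_is_path\<close> applies.
\<close>
lemma selected_arcs_form_path:
  assumes inst: "bpmp_instance I" and feas: "triples_feasible I (x, y, \<theta>, u, s)"
  obtains v m where "route I v m" "set (path_arcs v 0 m) = {(i, j) \<in> arc_set I. x i j = 1}"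
proof -
  let ?n = "num_nodes I" and ?A = "arc_set I"
  let ?E = "{(i, j) \<in> ?A. x i j = 1}"
  note D = triples_feasibleD[OF feas]
  have n: "?n \<ge> 2" using inst by (simp add: bpmp_instance_def)
  have out: "(\<Sum>j\<in>nodes I - {1, k}. x k j) = real (card {j. (k, j) \<in> ?E})"
    if "k \<in> nodes I" "k \<noteq> ?n" for k
  proof -
    have "{j \<in> nodes I - {1, k}. x k j = 1} = {j. (k, j) \<in> ?E}"
      using that by (auto simp: arc_set_def nodes_def)
    then show ?thesis
      using sum_zero_one_eq_card[of "nodes I - {1, k}" "x k"] D(11)[of k] that
      by (auto simp: nodes_def arc_set_def)
  qed
  have inn: "(\<Sum>i\<in>nodes I - {k, ?n}. x i k) = real (card {i. (i, k) \<in> ?E})"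
    if "k \<in> nodes I" "k \<noteq> 1" for k
  proof -
    have "{i \<in> nodes I - {k, ?n}. x i k = 1} = {i. (i, k) \<in> ?E}"
      using that by (auto simp: arc_set_def nodes_def)
    then show ?thesis
      using sum_zero_one_eq_card[of "nodes I - {k, ?n}" "\<lambda>i. x i k"] D(11)[of _ k] that
      by (auto simp: nodes_def arc_set_def)
  qed
  have "nodes I - {1, 1} = {2..?n}" "nodes I - {?n, ?n} = {1..?n - 1}"
    by (auto simp: nodes_def)
  then have out1: "card {j. (1, j) \<in> ?E} = 1" and inn_n: "card {i. (i, ?n) \<in> ?E} = 1"
    using out[of 1] inn[of ?n] D(1,2) n by (auto simp: nodes_def)
  have "\<exists>P. set P = ?E \<and> pre_digraph.cas (bpmp_graph I) 1 P ?n \<and>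
          sorted_wrt (\<lambda>i j. s i < s j) (pre_digraph.awalk_verts (bpmp_graph I) 1 P)"
  proof (rule balanced_acyclic_is_path)
    show "finite ?E"
      by (rule finite_subset[OF _ finite_arc_set]) auto
    show "s i < s j" if "(i, j) \<in> ?E" for i j
      using that D(5)[of i j] by auto
    show "card {j. (k, j) \<in> ?E} + of_bool (k = ?n) = card {i. (i, k) \<in> ?E} + of_bool (k = 1)" for k
    proof -
      consider "k = 1" | "k = ?n" | "k \<in> nodes I - {1, ?n}" | "k \<notin> nodes I"
        by blast
      then show ?thesis
      proof cases
        case 1
        moreover have "{i. (i, 1) \<in> ?E} = {}" by (auto simp: arc_set_def)
        ultimately show ?thesis using out1 n by (simp only: card.empty) simp
      next
        case 2
        moreover have "{j. (?n, j) \<in> ?E} = {}" by (auto simp: arc_set_def)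
        ultimately show ?thesis using inn_n n by (simp only: card.empty) simp
      next
        case 3
        then show ?thesis using D(3)[of k] out[of k] inn[of k] by simp
      next
        case 4
        then have "{j. (k, j) \<in> ?E} = {}" "{i. (i, k) \<in> ?E} = {}" "k \<noteq> 1" "k \<noteq> ?n"
          using n by (auto simp: arc_set_def nodes_def)
        then show ?thesis by (simp only: card.empty)
      qed
    qed
  qed (simp_all add: bpmp_graph_def)
  then obtain P where P: "set P = ?E" "pre_digraph.cas (bpmp_graph I) 1 P ?n"
    "sorted_wrt (\<lambda>i j. s i < s j) (pre_digraph.awalk_verts (bpmp_graph I) 1 P)"
    by blast
  have "distinct vs" if "sorted_wrt (\<lambda>i j. s i < s j) vs" for vs
    using that by (induction vs) auto
  then have "distinct (pre_digraph.awalk_verts (bpmp_graph I) 1 P)"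
    using P(3) by blast
  moreover have "1 \<in> nodes I" using n by (simp add: nodes_def)
  ultimately have "pre_digraph.apath (bpmp_graph I) 1 P ?n"
    using P(1,2) by (auto simp: pre_digraph.apath_def pre_digraph.awalk_def bpmp_graph_def)
  then show ?thesis
    using apath_imp_route[OF inst] P(1) that by metis
qed

context route
begin

text \<open>
  Since \<open>u i j k\<close> vanishes unless \<open>(i, k)\<close> is an arc of the route, goods destined for \<open>j\<close> can only be
  diverted along the route. They accumulate from node to node until they reach \<open>j\<close>, and they
  cannot be diverted through the last node, as it is never an upper index of \<open>u\<close>. So every accepted
  request is served (otherwise its weight would have nowhere to go), and \<open>\<theta>\<close> is at least the load.
  The inequality suffices, because carrying load costs money.
\<close>
lemma bpmp_solution_of_selected_route:
  assumes feas: "triples_feasible I (x, y, \<theta>, u, s)"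
    and P: "set P = {(i, j) \<in> arc_set I. x i j = 1}"
  defines "S \<equiv> {(k, l) \<in> requests I. y k l = 1}"
  shows "bpmp_feasible I (P, S)"
    and "triples_objective I (x, y, \<theta>, u, s) \<le> bpmp_profit I (P, S)"
proof -
  note D = triples_feasibleD[OF feas]
  \<comment> \<open>The balance constraint for \<open>(i, j)\<close> reads \<open>\<theta> = wy + through + inflow - outflow\<close>: goods accepted for the
      arc, goods for further destinations that are diverted onto it through \<open>j\<close> (\<open>through\<close>), goods for \<open>j\<close>
      that were diverted through \<open>i\<close> (\<open>inflow\<close>), and goods diverted away from it (\<open>outflow\<close>).\<close>
  define wy where "wy i j = (if (i, j) \<in> requests I then weight I i j * y i j else 0)" for i j
  define through where "through i j = (\<Sum>k \<in> {k. (i, k, j) \<in> triples I}. u i k j)" for i j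
  define inflow where "inflow i j = (\<Sum>k \<in> {k. (k, j, i) \<in> triples I}. u k j i)" for i j
  define outflow where "outflow i j = (\<Sum>k \<in> {k. (i, j, k) \<in> triples I}. u i j k)" for i j
  have S: "S \<subseteq> requests I" by (auto simp: S_def)
  have finS: "finite S" using S finite_requests finite_subset by blast
  have bal: "\<theta> i j = wy i j + through i j + inflow i j - outflow i j"
    if "(i, j) \<in> arc_set I" for i j
    using D(7)[OF that] by (simp add: wy_def through_def inflow_def outflow_def)
  have wy: "wy i j = (if (i, j) \<in> S then weight I i j else 0)" for i j
    using D(12)[of i j] by (auto simp: wy_def S_def)
  have wy_nonneg: "wy i j \<ge> 0" for i j
    using weight_pos[of i j] S by (auto simp: wy)
  have inflow_nonneg: "inflow i j \<ge> 0" for i j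
    unfolding inflow_def by (intro sum_nonneg) (auto intro: D(10))
  have u_off: "u i j k = 0" if "(i, j, k) \<in> triples I" "(i, k) \<notin> set P" for i j k
  proof -
    have "(i, k) \<in> arc_set I" using that(1) by (auto simp: triples_def arc_set_def nodes_def)
    then have "x i k = 0" using that(2) P D(11)[of i k] by auto
    then show ?thesis using D(9,10)[OF that(1)] by simp
  qed
  have \<theta>_off: "\<theta> i j = 0" if "(i, j) \<in> arc_set I" "(i, j) \<notin> set P" for i j
  proof -
    have "x i j = 0" using that P D(11)[of i j] by auto
    then show ?thesis using D(6,8)[OF that(1)] by simp
  qed
  have through_off: "through i j = 0" if "(i, j) \<notin> set P" for i j
    unfolding through_def using that u_off by (intro sum.neutral) auto
  have outflow_off: "outflow i j = 0" if "i \<notin> v ` {..<m}" for i j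
    unfolding outflow_def using that u_off arc_in_P_dest(1) by (intro sum.neutral) blast
  have outflow_at: "outflow (v c) j =
      (if (v c, j, v (Suc c)) \<in> triples I then u (v c) j (v (Suc c)) else 0)" if "c < m" for c j
  proof -
    have "outflow (v c) j = (if v (Suc c) \<in> {k. (v c, j, k) \<in> triples I}
      then u (v c) j (v (Suc c)) else 0)"
      unfolding outflow_def
      by (rule sum_single) (use that u_off arc_in_P_iff(1)[of c] finite_triples_sections in auto)
    then show ?thesis by simp
  qed
  have inflow_at: "inflow (v (Suc c)) j =
      (if (v c, j, v (Suc c)) \<in> triples I then u (v c) j (v (Suc c)) else 0)" if "c < m" for c j
  proof -
    have "inflow (v (Suc c)) j = (if v c \<in> {k. (k, j, v (Suc c)) \<in> triples I}
      then u (v c) j (v (Suc c)) else 0)"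
      unfolding inflow_def
      by (rule sum_single) (use that u_off arc_in_P_iff(2)[of c] finite_triples_sections in auto)
    then show ?thesis by simp
  qed
  \<comment> \<open>What is diverted from \<open>(v c, j)\<close> can only go through the next node, and only from \<open>v c\<close> can goods
      be diverted through that node.\<close>
  have conserved: "inflow (v (Suc c)) j = outflow (v c) j" if "c < m" for c j
    using that inflow_at outflow_at by simp
  have inflow_first: "inflow (v 0) j = 0" for j
    unfolding inflow_def by (intro sum.neutral) (auto simp: triples_def first)
  have inflow_last: "inflow (v m) j = 0" for j
    unfolding inflow_def by (intro sum.neutral) (auto simp: triples_def last)
  \<comment> \<open>On an unselected arc nothing may remain, so all goods for \<open>j\<close> at \<open>i\<close> are diverted.\<close>
  have step: "wy i j + inflow i j = outflow i j"
    if "(i, j) \<in> arc_set I" "(i, j) \<notin> set P" for i j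
    using bal[OF that(1)] \<theta>_off[OF that] through_off[OF that(2)] by simp
  have step_at: "wy (v c) j + inflow (v c) j = outflow (v c) j"
    if "c < m" "j \<in> nodes I" "j \<noteq> 1" "j \<noteq> v c" "j \<noteq> v (Suc c)" for c j
  proof (rule step)
    show "(v c, j) \<in> arc_set I"
      using that in_nodes[of c] v_eq_last_iff[of c] by (auto simp: arc_set_def nodes_def)
    show "(v c, j) \<notin> set P" using that arc_in_P_iff(1)[of c j] by simp
  qed

  \<comment> \<open>Nothing destined for a node that does not lie ahead may reach a position. This is shown backwards
      from the end of the route, where goods cannot be diverted any further.\<close>
  have stranded: "inflow (v c) j = 0 \<and> (c < m \<longrightarrow> wy (v c) j = 0)"
    if "c \<le> m" "j \<in> nodes I" "j \<noteq> 1" "j \<notin> v ` {c..m}" for c j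
    using that(1,4)
  proof (induction c rule: inc_induct)
    case base
    then show ?case by (simp add: inflow_last)
  next
    case (step c)
    then have "j \<notin> v ` {Suc c..m}" "j \<noteq> v c" "j \<noteq> v (Suc c)" by auto
    then have "wy (v c) j + inflow (v c) j = 0"
      using step step_at[of c j] conserved[of c j] that(2,3) by simp
    then show ?case using wy_nonneg[of "v c" j] inflow_nonneg[of "v c" j] by linarith
  qed

  \<comment> \<open>Off the route nothing can be diverted; on it, \<open>l\<close> must lie ahead of \<open>k\<close> by the previous fact.\<close>
  have served: "\<exists>q. route_part I P k l q" if "(k, l) \<in> S" for k l
  proof -
    have arc: "(k, l) \<in> arc_set I" using that S requests_subset by auto
    have wy_pos: "wy k l > 0" using that S weight_pos by (auto simp: wy)
    have "k \<in> v ` {..<m}"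
    proof (rule ccontr)
      assume "k \<notin> v ` {..<m}"
      then have "wy k l + inflow k l = 0"
        using step[OF arc] outflow_off arc_in_P_dest(1) by force
      then show False using wy_pos inflow_nonneg[of k l] by linarith
    qed
    then obtain a where a: "a < m" "k = v a" by auto
    then have "l \<in> v ` {a..m}"
      using stranded[of a l] wy_pos arc by (auto simp: arc_set_def)
    then obtain b where b: "a \<le> b" "b \<le> m" "l = v b" by auto
    moreover have "a \<noteq> b" using arc a b by (auto simp: arc_set_def)
    ultimately have "a < b" by simp
    then show ?thesis using a b served_iff by blast
  qed

  \<comment> \<open>As long as \<open>j\<close> has not been reached, the goods for \<open>j\<close> at a node are those accepted there and at
      all nodes before.\<close>
  have gathered: "wy (v c) j + inflow (v c) j = carried S c j"
    if "c < m" "j \<in> nodes I" "j \<noteq> 1" "j \<notin> v ` {..c}" for c j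
    using that(1,4)
  proof (induction c)
    case 0
    then show ?case using inflow_first[of j] by (simp add: carried_def wy)
  next
    case (Suc c)
    then have "j \<noteq> v c" "j \<noteq> v (Suc c)" "j \<notin> v ` {..c}" by auto
    then have "inflow (v (Suc c)) j = carried S c j"
      using Suc step_at[of c j] conserved[of c j] that(2,3) by simp
    then show ?case by (simp add: carried_Suc wy)
  qed

  have load_le: "load I P S (v c) (v (Suc c)) \<le> \<theta> (v c) (v (Suc c))" if c: "c < m" for c
  proof -
    have later: "v b \<in> nodes I" "v b \<noteq> 1" "v b \<notin> v ` {..c}" if "Suc c \<le> b" "b \<le> m" for b
      using that c in_nodes[of b] v_eq_first_iff[of b] by (auto simp: v_eq_iff)
    have triple: "(v c, v b, v (Suc c)) \<in> triples I" if "Suc c < b" "b \<le> m" for b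
      using that c in_nodes[of b] in_nodes[of c] in_nodes[of "Suc c"]
      by (auto simp: triples_def v_eq_iff v_eq_first_iff v_eq_last_iff)
    \<comment> \<open>The arc leaving \<open>v c\<close> also takes the goods for each destination beyond \<open>v (Suc c)\<close>: they are
        diverted onto it, since their direct arc carries nothing.\<close>
    have "u (v c) (v b) (v (Suc c)) = carried S c (v b)" if b: "Suc c < b" "b \<le> m" for b
    proof -
      have "v b \<noteq> v c" "v b \<noteq> v (Suc c)" using b c by (auto simp: v_eq_iff)
      then show ?thesis
        using outflow_at[OF c, of "v b"] triple[OF b] step_at[OF c, of "v b"]
          gathered[OF c, of "v b"] later[of b] b by simp
    qed
    then have "(\<Sum>b\<in>{Suc c<..m}. carried S c (v b)) = (\<Sum>b\<in>{Suc c<..m}. u (v c) (v b) (v (Suc c)))"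
      by simp
    also have "\<dots> = (\<Sum>k\<in>v ` {Suc c<..m}. u (v c) k (v (Suc c)))"
      by (subst sum.reindex) (auto intro: inj_on_subset[OF inj])
    also have "\<dots> \<le> through (v c) (v (Suc c))"
      unfolding through_def
      by (rule sum_mono2[OF finite_triples_sections(2)]) (use triple D(10) in auto)
    finally have *: "(\<Sum>b\<in>{Suc c<..m}. carried S c (v b)) \<le> through (v c) (v (Suc c))" .
    have "outflow (v c) (v (Suc c)) = 0"
      using outflow_at[OF c] by (auto simp: triples_def)
    moreover have "wy (v c) (v (Suc c)) + inflow (v c) (v (Suc c)) = carried S c (v (Suc c))"
      using gathered[OF c] later[of "Suc c"] c by simp
    moreover have "load I P S (v c) (v (Suc c))
        = carried S c (v (Suc c)) + (\<Sum>b\<in>{Suc c<..m}. carried S c (v b))"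
      using load_eq_carried[OF c finS] c by (simp add: sum.head)
    moreover have "(v c, v (Suc c)) \<in> arc_set I" using c by (intro arc_between) auto
    ultimately show ?thesis using bal[of "v c" "v (Suc c)"] * by simp
  qed
  then have load_le_\<theta>: "load I P S i j \<le> \<theta> i j" if "(i, j) \<in> set P" for i j
    using that by (auto simp: set_path_arcs)
  have x: "x i j = of_bool ((i, j) \<in> set P)" if "(i, j) \<in> arc_set I" for i j
    using D(11)[OF that] P that by auto
  have dist: "(\<Sum>(i, j)\<in>arc_set I. distance I i j * x i j) = (\<Sum>(i, j)\<in>set P. distance I i j)"
    unfolding sum_arc_set_indicator[of "distance I", symmetric] using x by (intro sum.cong) auto
  show "bpmp_feasible I (P, S)"
  proof -
    have "load I P S i j \<le> capacity I" if "(i, j) \<in> set P" for i j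
      using load_le_\<theta>[OF that] D(6)[of i j] x[of i j] that set_P_subset by force
    then show ?thesis
      using apath D(4) dist S served by auto
  qed
  have "(\<Sum>(i, j)\<in>set P. distance I i j * load I P S i j)
      \<le> (\<Sum>(i, j)\<in>set P. distance I i j * \<theta> i j)"
    using load_le_\<theta> inst set_P_subset
    by (intro sum_mono) (auto simp: bpmp_instance_def intro!: mult_left_mono)
  also have "\<dots> = (\<Sum>(i, j)\<in>arc_set I. distance I i j * \<theta> i j)"
    by (rule sum.mono_neutral_left[OF finite_arc_set set_P_subset]) (use \<theta>_off in auto)
  finally have "travel_cost I * (\<Sum>(i, j)\<in>set P. distance I i j * load I P S i j)
      \<le> travel_cost I * (\<Sum>(i, j)\<in>arc_set I. distance I i j * \<theta> i j)"
    using inst by (intro mult_left_mono) (auto simp: bpmp_instance_def)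
  moreover have "(\<Sum>(k, l)\<in>requests I. distance I k l * weight I k l * y k l)
      = (\<Sum>(k, l)\<in>S. distance I k l * weight I k l)"
    by (rule sum.mono_neutral_cong_right[OF finite_requests S]) (use D(12) in \<open>force simp: S_def\<close>)+
  ultimately show "triples_objective I (x, y, \<theta>, u, s) \<le> bpmp_profit I (P, S)"
    using dist by simp
qed

end


section \<open>Equality of the optimal values\<close>

text \<open>
  There are finitely many simple paths and sets of requests, so a maximum is attained. For the triples
  formulation, where \<open>\<theta>\<close>, \<open>u\<close> and \<open>s\<close> are continuous, attainment is inherited from here.
\<close>
lemma finite_bpmp_solutions:
  assumes "bpmp_instance I"
  shows "finite {z. bpmp_feasible I z}"
proof -
  interpret fin_digraph "bpmp_graph I"
    by standard (use finite_arc_set in \<open>auto simp: bpmp_graph_def arc_set_def nodes_def\<close>)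
  have "requests I \<subseteq> arc_set I" using assms by (simp add: bpmp_instance_def)
  then have "finite (requests I)" using finite_arc_set finite_subset by blast
  then have "finite ({P. apath 1 P (num_nodes I)} \<times> Pow (requests I))"
    using apaths_finite by blast
  then show ?thesis by (rule rev_finite_subset) auto
qed

theorem theorem4:
  fixes I :: bpmp
  assumes "bpmp_instance I"
  shows "(\<exists>v. has_max_value (triples_objective I) (triples_feasible I) v \<and>
              has_max_value (bpmp_profit I) (bpmp_feasible I) v) \<and>
         (\<forall>x y \<theta> u s.
            is_arg_max (triples_objective I) (triples_feasible I) (x, y, \<theta>, u, s) \<longrightarrow>
            (\<exists>P. set P = {(i, j) \<in> arc_set I. x i j = 1} \<and>
                 is_arg_max (bpmp_profit I) (bpmp_feasible I)
                   (P, {(k, l) \<in> requests I. y k l = 1})))"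
proof -
  have encode: "\<exists>t. triples_feasible I t \<and> triples_objective I t = bpmp_profit I z"
    if feas: "bpmp_feasible I z" for z
  proof -
    obtain P S where z: "z = (P, S)" by (cases z)
    with feas have "pre_digraph.apath (bpmp_graph I) 1 P (num_nodes I)" by simp
    then obtain v m where "route I v m" "P = path_arcs v 0 m"
      using apath_imp_route[OF assms] by blast
    then show ?thesis using route.triples_solution_of_route feas z by blast
  qed
  have decode: "\<exists>P. set P = {(i, j) \<in> arc_set I. x i j = 1} \<and>
      bpmp_feasible I (P, {(k, l) \<in> requests I. y k l = 1}) \<and>
      triples_objective I (x, y, \<theta>, u, s) \<le> bpmp_profit I (P, {(k, l) \<in> requests I. y k l = 1})"
    if feas: "triples_feasible I (x, y, \<theta>, u, s)" for x y \<theta> u s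
  proof -
    obtain v m where "route I v m" "set (path_arcs v 0 m) = {(i, j) \<in> arc_set I. x i j = 1}"
      using selected_arcs_form_path[OF assms feas] by blast
    then show ?thesis using route.bpmp_solution_of_selected_route[OF _ feas] by blast
  qed
  then have decode': "\<exists>z. bpmp_feasible I z \<and> triples_objective I t \<le> bpmp_profit I z"
    if "triples_feasible I t" for t
    using that by (cases t) blast
  have "\<exists>v. has_max_value (triples_objective I) (triples_feasible I) v \<and>
            has_max_value (bpmp_profit I) (bpmp_feasible I) v"
  proof (cases "\<exists>z. bpmp_feasible I z")
    case True
    let ?F = "{z. bpmp_feasible I z}"
    have "Max (bpmp_profit I ` ?F) \<in> bpmp_profit I ` ?F"
      using True finite_bpmp_solutions[OF assms] by (intro Max_in) auto
    then obtain z where z: "bpmp_feasible I z" "bpmp_profit I z = Max (bpmp_profit I ` ?F)"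
      by auto
    have best: "bpmp_profit I z' \<le> bpmp_profit I z" if "bpmp_feasible I z'" for z'
      using that finite_bpmp_solutions[OF assms] unfolding z(2) by (intro Max_ge) auto
    obtain t where t: "triples_feasible I t" "triples_objective I t = bpmp_profit I z"
      using encode[OF z(1)] by blast
    have "is_arg_max (bpmp_profit I) (bpmp_feasible I) z"
      using z(1) best by (simp add: is_arg_max_linorder)
    moreover have "is_arg_max (triples_objective I) (triples_feasible I) t"
      unfolding is_arg_max_linorder using t best decode' order_trans by metis
    ultimately show ?thesis
      using t z(1) unfolding has_max_value_def by metis
  next
    case False
    then have "\<not> (\<exists>t. triples_feasible I t)" using decode' by blast
    then show ?thesis using False unfolding has_max_value_def by simp
  qed
  moreover have "\<exists>P. set P = {(i, j) \<in> arc_set I. x i j = 1} \<and>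
      is_arg_max (bpmp_profit I) (bpmp_feasible I) (P, {(k, l) \<in> requests I. y k l = 1})"
    if opt: "is_arg_max (triples_objective I) (triples_feasible I) (x, y, \<theta>, u, s)" for x y \<theta> u s
  proof -
    have "triples_feasible I (x, y, \<theta>, u, s)" using opt by (simp add: is_arg_max_def)
    then obtain P where P: "set P = {(i, j) \<in> arc_set I. x i j = 1}"
      "bpmp_feasible I (P, {(k, l) \<in> requests I. y k l = 1})"
      "triples_objective I (x, y, \<theta>, u, s) \<le> bpmp_profit I (P, {(k, l) \<in> requests I. y k l = 1})"
      using decode by blast
    have "bpmp_profit I z \<le> bpmp_profit I (P, {(k, l) \<in> requests I. y k l = 1})"
      if z: "bpmp_feasible I z" for z
    proof -
      obtain t where t: "triples_feasible I t" "triples_objective I t = bpmp_profit I z"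
        using encode[OF z] by blast
      then have "bpmp_profit I z \<le> triples_objective I (x, y, \<theta>, u, s)"
        using opt unfolding is_arg_max_linorder by metis
      then show ?thesis using P(3) by (rule order_trans)
    qed
    then show ?thesis using P(1,2) unfolding is_arg_max_linorder by blast
  qed
  ultimately show ?thesis by blast
qed

end
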